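(* Let $0<q<1$, $0<a<q^{-1}$, $0<b<q^{-1}$, $c<0$ and $n\in\mathbb{N}$. Then for all $x$, $$\sum_{k=0}^n\frac{(q^{-n},xb/c;q)_k}{(q,aq,cq;q)_k}(ac)^kq^{k(k+n+1)}\,P_{n-k}(xq^k;aq^k,bq^k,cq^k;q)=\left(\frac cb\right)^n\frac{(bq,abq/c;q)_n}{(aq,cq;q)_n}\,P_n(xb/c;b,0,ab/c;q).$$
   Context: $\mathbb N=\{0,1,2,\dots\}$. $(y;q)_k=\prod_{j=0}^{k-1}(1-yq^j)$ and $(y_1,\dots,y_r;q)_k=\prod_i(y_i;q)_k$; $abq/c$ means $abqc^{-1}$. The big $q$-Jacobi polynomials are $$P_n(x;a,b,c;q)=\sum_{j=0}^n\frac{(q^{-n},abq^{n+1},x;q)_j}{(aq,cq,q;q)_j}q^j;$$ the case where the second parameter is $0$ gives the big $q$-Laguerre polynomials. *)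

theory Defs
  imports Complex_Main
begin

definition qpoch :: "'a::field \<Rightarrow> 'a \<Rightarrow> nat \<Rightarrow> 'a" where
  "qpoch y q k = (\<Prod>j<k. 1 - y * q ^ j)"

text \<open>The multi-parameter symbol \<open>(y\<^sub>1, \<dots>, y\<^sub>r; q)\<^sub>k\<close>.\<close>

definition qpochs :: "'a::field list \<Rightarrow> 'a \<Rightarrow> nat \<Rightarrow> 'a" where
  "qpochs ys q k = (\<Prod>y\<leftarrow>ys. qpoch y q k)"

definition big_q_jacobi :: "nat \<Rightarrow> 'a::field \<Rightarrow> 'a \<Rightarrow> 'a \<Rightarrow> 'a \<Rightarrow> 'a \<Rightarrow> 'a" where
  "big_q_jacobi n x a b c q =
     (\<Sum>j\<le>n. qpochs [q powi (- int n), a * b * q ^ (n + 1), x] q j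
             / qpochs [a * q, c * q, q] q j * q ^ j)"

end

theory Submission
  imports Defs
begin

text \<open>
  Write \<open>s = c / b\<close> and \<open>y = x b / c\<close>, so that \<open>x = y s\<close> and \<open>c = s b\<close>. The theorem compares
  coefficients of \<open>(y; q)\<^sub>m\<close>, and the reason it can is a symmetry of the big q-Jacobi polynomials:
  up to an explicit constant, \<open>P\<^sub>n(x; a, b, c; q)\<close> equals \<open>P\<^sub>n(y; b, a, a b / c; q)\<close>
  (\<open>big_q_jacobi_symmetry\<close>). The shift \<open>x, a, b, c \<mapsto> x q\<^sup>k, a q\<^sup>k, b q\<^sup>k, c q\<^sup>k\<close> on the left-hand
  side turns \<open>y\<close> into \<open>y q\<^sup>k\<close>, and \<open>(y; q)\<^sub>k (y q\<^sup>k; q)\<^sub>j = (y; q)\<^sub>k\<^sub>+\<^sub>j\<close>. Hence after applying the symmetry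
  to every summand, the double sum is a combination of the \<open>(y; q)\<^sub>m\<close> with \<open>m = k + j\<close>; all other
  symbols combine in the same way, except for an inner sum over \<open>k \<le> m\<close>, which is the
  elementary identity \<open>sum_qbinom_qpoch_eq_1\<close> at \<open>A = a b q\<^sup>n\<^sup>+\<^sup>1\<close>. It removes the
  factor \<open>(a b q\<^sup>n\<^sup>+\<^sup>1; q)\<^sub>m\<close>, and this is how the second parameter \<open>a\<close> of the reflected
  polynomials degenerates to \<open>0\<close>, leaving a big q-Laguerre polynomial.

  For the symmetry, \<open>(y s; q)\<^sub>j\<close> is expanded in the \<open>(y; q)\<^sub>k\<close> by the q-binomial theorem
  \<open>qpoch_mult\<close>. The coefficient of \<open>(y; q)\<^sub>k\<close> is then a terminating balanced \<open>\<^sub>3\<phi>\<^sub>2\<close>, which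
  the q-Pfaff-Saalschuetz formula (\<open>q_pfaff_saalschutz\<close>) evaluates as a product.

  The argument is purely algebraic and is carried out over an arbitrary field; the inequalities
  on the real parameters serve to keep the denominators away from zero.
\<close>

section \<open>The q-shifted factorial\<close>

lemma qpoch_0 [simp]: "qpoch y q 0 = 1"
  by (simp add: qpoch_def)

lemma qpoch_Suc: "qpoch y q (Suc k) = qpoch y q k * (1 - y * q ^ k)"
  by (simp add: qpoch_def)

lemma qpoch_add: "qpoch y q (m + k) = qpoch y q m * qpoch (y * q ^ m) q k"
  by (induction k) (simp_all add: qpoch_Suc power_add mult.assoc)

lemma qpoch_Suc_left: "qpoch y q (Suc k) = (1 - y) * qpoch (y * q) q k"
  using qpoch_add[of y q 1 k] by (simp add: qpoch_Suc)

lemma qpoch_split: "k \<le> n \<Longrightarrow> qpoch y q n = qpoch y q k * qpoch (y * q ^ k) q (n - k)"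
  using qpoch_add[of y q k "n - k"] by simp

lemma qpoch_nonzero_mono: "qpoch y q n \<noteq> 0 \<Longrightarrow> k \<le> n \<Longrightarrow> qpoch y q k \<noteq> 0"
  by (simp add: qpoch_split)

lemma qpoch_inverse_power_eq_0:
  assumes "q \<noteq> 0" "n < k"
  shows "qpoch (inverse (q ^ n)) q k = 0"
  using assms by (auto simp: qpoch_def intro!: bexI[of _ n])

lemma qpoch_inverse_power_shift:
  fixes q :: "'a::field"
  assumes "q \<noteq> 0" "k \<le> n"
  shows "inverse (q ^ n) * q ^ k = inverse (q ^ (n - k))"
  using assms power_add[of q k "n - k"] by (simp add: field_simps)

section \<open>Gaussian binomial coefficients\<close>

text \<open>The Pascal recursion, rather than a quotient of q-factorials, makes sense for every \<open>q\<close>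
  (also at roots of unity) and makes the coefficients vanish for \<open>k > n\<close>.\<close>

fun qbinom :: "'a::field \<Rightarrow> nat \<Rightarrow> nat \<Rightarrow> 'a" where
  "qbinom q n 0 = 1"
| "qbinom q 0 (Suc k) = 0"
| "qbinom q (Suc n) (Suc k) = qbinom q n k + q ^ Suc k * qbinom q n (Suc k)"

lemma qbinom_eq_0: "n < k \<Longrightarrow> qbinom q n k = 0"
  by (induction q n k rule: qbinom.induct) auto

lemma qbinom_fact:
  "k \<le> n \<Longrightarrow> qbinom q n k * (qpoch q q k * qpoch q q (n - k)) = qpoch q q n"
proof (induction q n k rule: qbinom.induct)
  case (3 q n k)
  show ?case
  proof (cases "k = n")
    case True
    then show ?thesis using 3 by (simp add: qbinom_eq_0 qpoch_Suc mult.assoc [symmetric])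
  next
    case False
    then obtain d where d: "n = k + Suc d" using 3 less_imp_Suc_add[of k n] by auto
    have a: "qbinom q n k * (qpoch q q k * qpoch q q (Suc d)) = qpoch q q n"
      and b: "qbinom q n (Suc k) * (qpoch q q (Suc k) * qpoch q q d) = qpoch q q n"
      using 3 d by auto
    have "qbinom q (Suc n) (Suc k) * (qpoch q q (Suc k) * qpoch q q (Suc n - Suc k)) =
      (qbinom q n k * (qpoch q q k * qpoch q q (Suc d))) * (1 - q ^ Suc k)
      + q ^ Suc k * (1 - q ^ Suc d) * (qbinom q n (Suc k) * (qpoch q q (Suc k) * qpoch q q d))"
      by (simp add: d qpoch_Suc algebra_simps)
    also have "\<dots> = qpoch q q (Suc n)"
      unfolding a b by (simp add: d qpoch_Suc algebra_simps power_add)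
    finally show ?thesis .
  qed
qed auto

text \<open>Both sides are \<open>(q; q)\<^sub>n / ((q; q)\<^sub>k (q; q)\<^sub>n\<^sub>-\<^sub>k\<^sub>-\<^sub>1)\<close> where this quotient is defined. It turns
  one Pascal rule into the other.\<close>

lemma qbinom_absorb:
  "k \<le> n \<Longrightarrow> (1 - q ^ Suc k) * qbinom q n (Suc k) = (1 - q ^ (n - k)) * qbinom q n k"
proof (induction n arbitrary: k)
  case (Suc n)
  show ?case
  proof (cases "k = Suc n")
    case True then show ?thesis by (simp add: qbinom_eq_0)
  next
    case False
    with Suc have k: "k \<le> n" by simp
    note 1 = Suc.IH[OF k]
    show ?thesis
    proof (cases k)
      case 0
      have "(1 - q) * (1 + q * qbinom q n (Suc 0)) = 1 - q + q * ((1 - q) * qbinom q n (Suc 0))"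
        by (simp add: algebra_simps)
      also have "(1 - q) * qbinom q n (Suc 0) = 1 - q ^ n"
        using 1 0 by simp
      also have "1 - q + q * (1 - q ^ n) = 1 - q * q ^ n"
        by (simp add: algebra_simps)
      finally show ?thesis using 0 by simp
    next
      case (Suc l)
      with k obtain d where d: "n = Suc l + d" using le_Suc_ex by blast
      have 2: "(1 - q ^ k) * qbinom q n k = (1 - q ^ Suc d) * qbinom q n l"
        using Suc.IH[of l] d Suc by simp
      have 3: "(1 - q ^ Suc k) * qbinom q n (Suc k) = (1 - q ^ d) * qbinom q n k"
        using 1 d Suc by simp
      have "(1 - q ^ Suc k) * qbinom q (Suc n) (Suc k) =
        (1 - q ^ Suc k) * qbinom q n k + q ^ Suc k * ((1 - q ^ Suc k) * qbinom q n (Suc k))"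
        by (simp add: algebra_simps)
      also have "\<dots> = (1 - q ^ Suc d) * (q ^ k * qbinom q n k) + (1 - q ^ k) * qbinom q n k"
        unfolding 3 by (simp add: algebra_simps)
      also have "\<dots> = (1 - q ^ (Suc n - k)) * qbinom q (Suc n) k"
        unfolding 2 using d Suc by (simp add: algebra_simps)
      finally show ?thesis .
    qed
  qed
qed simp

lemma qbinom_Suc_Suc':
  assumes "k \<le> n"
  shows "qbinom q (Suc n) (Suc k) = q ^ (n - k) * qbinom q n k + qbinom q n (Suc k)"
  using qbinom_absorb[OF assms, of q] by (simp add: algebra_simps)

text \<open>The two Pascal rules in summed form: an identity for q-binomial sums follows by induction
  once the bracket on the right is recognised as a multiple, or a shift, of \<open>f k\<close>.\<close>

lemma sum_qbinom_Suc:
  "(\<Sum>k\<le>Suc n. qbinom q (Suc n) k * f k) = (\<Sum>k\<le>n. qbinom q n k * (q ^ k * f k + f (Suc k)))"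
proof -
  have "(\<Sum>k\<le>n. qbinom q n k * (q ^ k * f k)) = (\<Sum>k\<le>Suc n. qbinom q n k * (q ^ k * f k))"
    by (simp add: qbinom_eq_0)
  also have "\<dots> = f 0 + (\<Sum>k\<le>n. qbinom q n (Suc k) * (q ^ Suc k * f (Suc k)))"
    by (subst sum.atMost_Suc_shift) simp
  finally show ?thesis
    by (subst sum.atMost_Suc_shift) (simp add: algebra_simps sum.distrib)
qed

lemma sum_qbinom_Suc':
  "(\<Sum>k\<le>Suc n. qbinom q (Suc n) k * f k) = (\<Sum>k\<le>n. qbinom q n k * (f k + q ^ (n - k) * f (Suc k)))"
proof -
  have "(\<Sum>k\<le>n. qbinom q n k * f k) = (\<Sum>k\<le>Suc n. qbinom q n k * f k)"
    by (simp add: qbinom_eq_0)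
  also have "\<dots> = f 0 + (\<Sum>k\<le>n. qbinom q n (Suc k) * f (Suc k))"
    by (subst sum.atMost_Suc_shift) simp
  finally have "(\<Sum>k\<le>n. qbinom q n k * f k) = \<dots>" .
  moreover have "(\<Sum>k\<le>n. qbinom q (Suc n) (Suc k) * f (Suc k)) =
      (\<Sum>k\<le>n. (q ^ (n - k) * qbinom q n k + qbinom q n (Suc k)) * f (Suc k))"
    by (intro sum.cong refl) (simp only: qbinom_Suc_Suc' atMost_iff)
  ultimately show ?thesis
    by (subst sum.atMost_Suc_shift) (simp add: algebra_simps sum.distrib del: qbinom.simps(3))
qed

text \<open>The q-binomial theorem, and the change of basis from \<open>(y s; q)\<^sub>j\<close> to \<open>(y; q)\<^sub>k\<close>. The second
  Pascal rule applies, since \<open>(1 - s q\<^sup>d) + q\<^sup>d s (1 - y q\<^sup>k) = 1 - y s q\<^sup>k\<^sup>+\<^sup>d\<close> depends on \<open>k + d = j\<close>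
  only.\<close>

lemma qpoch_mult:
  "qpoch (y * s) q j = (\<Sum>k\<le>j. qbinom q j k * (s ^ k * qpoch y q k * qpoch s q (j - k)))"
proof (induction j)
  case (Suc j)
  have "(\<Sum>k\<le>Suc j. qbinom q (Suc j) k * (s ^ k * qpoch y q k * qpoch s q (Suc j - k)))
    = (\<Sum>k\<le>j. qbinom q j k * (s ^ k * qpoch y q k * qpoch s q (j - k)) * (1 - y * s * q ^ j))"
    unfolding sum_qbinom_Suc'
  proof (rule sum.cong)
    fix k assume "k \<in> {..j}"
    then obtain d where d: "j = k + d" by (auto simp: le_iff_add)
    show "qbinom q j k * (s ^ k * qpoch y q k * qpoch s q (Suc j - k)
        + q ^ (j - k) * (s ^ Suc k * qpoch y q (Suc k) * qpoch s q (Suc j - Suc k)))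
      = qbinom q j k * (s ^ k * qpoch y q k * qpoch s q (j - k)) * (1 - y * s * q ^ j)"
      by (simp add: d qpoch_Suc Suc_diff_le power_add algebra_simps)
  qed simp
  then show ?case
    by (simp add: qpoch_Suc Suc.IH sum_distrib_right)
qed simp

text \<open>The sum for \<open>m + 1\<close> at \<open>A\<close> equals the sum for \<open>m\<close> at \<open>A q\<close>: under the first Pascal rule the
  bracket is proportional to \<open>(1 - A q\<^sup>k) + A q\<^sup>k = 1\<close>.\<close>

lemma sum_qbinom_qpoch_eq_1:
  "(\<Sum>k\<le>m. qbinom q m k * (A ^ k * q ^ (k * (k - 1)) * qpoch (A * q ^ k) q (m - k))) = 1"
proof (induction m arbitrary: A)
  case (Suc m)
  have "(\<Sum>k\<le>Suc m. qbinom q (Suc m) k * (A ^ k * q ^ (k * (k - 1)) * qpoch (A * q ^ k) q (Suc m - k)))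
    = (\<Sum>k\<le>m. qbinom q m k * ((A * q) ^ k * q ^ (k * (k - 1)) * qpoch (A * q * q ^ k) q (m - k)))"
    unfolding sum_qbinom_Suc
  proof (rule sum.cong)
    fix k assume "k \<in> {..m}"
    then have 1: "Suc m - k = Suc (m - k)" by auto
    have 2: "q ^ (Suc k * (Suc k - 1)) = q ^ (k * (k - 1)) * q ^ k * q ^ k"
      by (cases k) (simp_all add: power_add power_mult_distrib algebra_simps)
    have 3: "A * q ^ Suc k = A * q ^ k * q" "A * q * q ^ k = A * q ^ k * q" by simp_all
    show "qbinom q m k * (q ^ k * (A ^ k * q ^ (k * (k - 1)) * qpoch (A * q ^ k) q (Suc m - k))
        + A ^ Suc k * q ^ (Suc k * (Suc k - 1)) * qpoch (A * q ^ Suc k) q (Suc m - Suc k))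
      = qbinom q m k * ((A * q) ^ k * q ^ (k * (k - 1)) * qpoch (A * q * q ^ k) q (m - k))"
      unfolding 1 2 3 qpoch_Suc_left by (simp add: power_mult_distrib algebra_simps)
  qed simp
  then show ?case using Suc.IH by simp
qed simp

section \<open>The q-Pfaff-Saalschuetz formula\<close>

text \<open>The rational function identity behind the telescoping below, with \<open>Q = q\<^sup>N\<close> and
  \<open>u = q\<^sup>i\<close>.\<close>

lemma q_pfaff_saalschutz_core:
  fixes Q q u s B C :: "'a::field"
  assumes "Q \<noteq> 0" "q \<noteq> 0"
  shows "(1 - C * Q) * (1 - s * B * Q) * (1 - inverse (q * Q)) * (1 - C * B * Q * u) * (q * u)
     - (s - C * Q) * (1 - B * Q) * (1 - inverse Q * u) * (1 - C * B * Q / q) * (q * u)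
     = (1 - C * B * Q\<^sup>2) * ((1 - inverse Q * u) * (1 - C * B * Q * u) * (1 - s * (q * u))
         - (1 - C * u) * (1 - s * B * u) * (1 - q * u))"
  using assms by (simp add: field_simps power2_eq_square)


text \<open>Creative telescoping in \<open>N\<close>. If \<open>S\<^sub>N\<close> denotes the full sum of \<open>T N\<close>, then the product formula to be
  shown amounts to \<open>(1 - C q\<^sup>N) (1 - s B q\<^sup>N) S\<^sub>N\<^sub>+\<^sub>1 = (s - C q\<^sup>N) (1 - B q\<^sup>N) S\<^sub>N\<close>. The difference of the
  two sides has partial sums in closed form, and these contain the factor \<open>(q\<^sup>-\<^sup>N; q)\<^sub>i\<close>, which
  vanishes at \<open>i = N + 1\<close>. The balancing condition is built into the parameters, whose last pair
  is \<open>s B\<close> and \<open>C B q\<^sup>N\<^sup>-\<^sup>1\<close>; the exponent is written as a division so that \<open>N = 0\<close> is covered.\<close>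

lemma q_pfaff_saalschutz_partial_sum:
  fixes q s B C :: "'a::field"
  defines "T \<equiv> \<lambda>N i. qpoch (inverse (q ^ N)) q i * qpoch (C * B * q ^ N / q) q i * qpoch s q i
      / (qpoch C q i * qpoch (s * B) q i * qpoch q q i) * q ^ i"
  assumes "q \<noteq> 0" and nz: "(1 - C * q ^ N) * (1 - s * B * q ^ N) \<noteq> 0"
    and "qpoch C q i \<noteq> 0" "qpoch (s * B) q i \<noteq> 0" "qpoch q q i \<noteq> 0"
  shows "(\<Sum>l\<le>i. (1 - C * q ^ N) * (1 - s * B * q ^ N) * T (Suc N) l
            - (s - C * q ^ N) * (1 - B * q ^ N) * T N l)
       = (1 - C * B * (q ^ N)\<^sup>2) * (qpoch (inverse (q ^ N)) q i * qpoch (C * B * q ^ N) q i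
            * qpoch s q (Suc i) / (qpoch C q i * qpoch (s * B) q i * qpoch q q i))"
  using assms(4-)
proof (induction i)
  case 0
  show ?case by (simp add: T_def qpoch_Suc power2_eq_square algebra_simps)
next
  case (Suc i)
  define X where "X = qpoch (inverse (q ^ N)) q i"
  define Y where "Y = qpoch (C * B * q ^ N) q i"
  define Z where "Z = qpoch s q (Suc i)"
  define V where "V = qpoch C q i * qpoch (s * B) q i * qpoch q q i"
  define W where "W = (1 - C * q ^ i) * (1 - s * B * q ^ i) * (1 - q * q ^ i)"
  have VW: "V \<noteq> 0" "W \<noteq> 0" using Suc.prems by (auto simp: V_def W_def qpoch_Suc)
  have den: "qpoch C q (Suc i) * qpoch (s * B) q (Suc i) * qpoch q q (Suc i) = V * W"
    by (simp add: V_def W_def qpoch_Suc)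
  have T1: "T (Suc N) (Suc i) = X * Y * Z / (V * W) *
      ((1 - inverse (q * q ^ N)) * (1 - C * B * q ^ N * q ^ i) * (q * q ^ i))"
  proof -
    have e: "inverse (q ^ Suc N) * q = inverse (q ^ N)" using \<open>q \<noteq> 0\<close> by simp
    have "qpoch (inverse (q ^ Suc N)) q (Suc i) = (1 - inverse (q * q ^ N)) * X"
      unfolding qpoch_Suc_left e X_def by simp
    moreover have "qpoch (C * B * q ^ Suc N / q) q (Suc i) = Y * (1 - C * B * q ^ N * q ^ i)"
      using \<open>q \<noteq> 0\<close> by (simp add: Y_def qpoch_Suc mult.assoc)
    ultimately show ?thesis unfolding T_def den Z_def [symmetric] by simp
  qed
  have T0: "T N (Suc i) = X * Y * Z / (V * W) *
      ((1 - inverse (q ^ N) * q ^ i) * (1 - C * B * q ^ N / q) * (q * q ^ i))"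
  proof -
    have e: "C * B * q ^ N / q * q = C * B * q ^ N" using \<open>q \<noteq> 0\<close> by simp
    have "qpoch (C * B * q ^ N / q) q (Suc i) = (1 - C * B * q ^ N / q) * Y"
      by (subst qpoch_Suc_left) (simp only: e Y_def)
    moreover have "qpoch (inverse (q ^ N)) q (Suc i) = X * (1 - inverse (q ^ N) * q ^ i)"
      by (simp add: X_def qpoch_Suc)
    ultimately show ?thesis unfolding T_def den Z_def [symmetric] by simp
  qed
  have G1: "qpoch (inverse (q ^ N)) q (Suc i) * qpoch (C * B * q ^ N) q (Suc i) * qpoch s q (Suc (Suc i))
      = X * Y * Z * ((1 - inverse (q ^ N) * q ^ i) * (1 - C * B * q ^ N * q ^ i) * (1 - s * (q * q ^ i)))"
    by (simp add: X_def Y_def Z_def qpoch_Suc)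
  have IH: "(\<Sum>l\<le>i. (1 - C * q ^ N) * (1 - s * B * q ^ N) * T (Suc N) l
            - (s - C * q ^ N) * (1 - B * q ^ N) * T N l)
       = (1 - C * B * (q ^ N)\<^sup>2) * (X * Y * Z / (V * W) * W)"
    using Suc VW by (simp add: qpoch_Suc X_def Y_def Z_def V_def mult.assoc)
  have "(1 - C * q ^ N) * (1 - s * B * q ^ N) * T (Suc N) (Suc i)
        - (s - C * q ^ N) * (1 - B * q ^ N) * T N (Suc i)
    = X * Y * Z / (V * W) *
      ((1 - C * q ^ N) * (1 - s * B * q ^ N) * (1 - inverse (q * q ^ N)) * (1 - C * B * q ^ N * q ^ i) * (q * q ^ i)
     - (s - C * q ^ N) * (1 - B * q ^ N) * (1 - inverse (q ^ N) * q ^ i) * (1 - C * B * q ^ N / q) * (q * q ^ i))"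
  proof -
    have "c1 * c2 * (M * (d1 * d2 * d3)) - c3 * c4 * (M * (e1 * e2 * d3))
        = M * (c1 * c2 * d1 * d2 * d3 - c3 * c4 * e1 * e2 * d3)"
      for c1 c2 c3 c4 d1 d2 d3 e1 e2 M :: 'a
      by (simp add: algebra_simps)
    then show ?thesis unfolding T1 T0 .
  qed
  also have "\<dots> = X * Y * Z / (V * W) * ((1 - C * B * (q ^ N)\<^sup>2) *
      ((1 - inverse (q ^ N) * q ^ i) * (1 - C * B * q ^ N * q ^ i) * (1 - s * (q * q ^ i)) - W))"
    unfolding W_def using \<open>q \<noteq> 0\<close>
    by (subst q_pfaff_saalschutz_core [where u = "q ^ i"]) simp_all
  finally have step: "(1 - C * q ^ N) * (1 - s * B * q ^ N) * T (Suc N) (Suc i)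
        - (s - C * q ^ N) * (1 - B * q ^ N) * T N (Suc i)
    = X * Y * Z / (V * W) * ((1 - C * B * (q ^ N)\<^sup>2) *
      ((1 - inverse (q ^ N) * q ^ i) * (1 - C * B * q ^ N * q ^ i) * (1 - s * (q * q ^ i)) - W))" .
  have alg: "g * (M * W) + M * (g * (E - W)) = g * (M * E)" for g M E :: 'a
    by (simp add: algebra_simps)
  show ?case
    unfolding sum.atMost_Suc IH step den G1 alg by simp
qed

text \<open>The product over \<open>s - C q\<^sup>i\<close> is \<open>s\<^sup>N (C / s; q)\<^sub>N\<close>, written without dividing by \<open>s\<close>.\<close>

lemma q_pfaff_saalschutz:
  fixes q s B C :: "'a::field"
  assumes "q \<noteq> 0" and "qpoch C q N \<noteq> 0" "qpoch (s * B) q N \<noteq> 0" "qpoch q q N \<noteq> 0"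
  shows "(\<Sum>i\<le>N. qpoch (inverse (q ^ N)) q i * qpoch (C * B * q ^ N / q) q i * qpoch s q i
            / (qpoch C q i * qpoch (s * B) q i * qpoch q q i) * q ^ i)
       = qpoch B q N * (\<Prod>i<N. s - C * q ^ i) / (qpoch C q N * qpoch (s * B) q N)"
  using assms(2-)
proof (induction N)
  case (Suc N)
  define T where "T = (\<lambda>N i. qpoch (inverse (q ^ N)) q i * qpoch (C * B * q ^ N / q) q i * qpoch s q i
      / (qpoch C q i * qpoch (s * B) q i * qpoch q q i) * q ^ i)"
  define D where "D = (1 - C * q ^ N) * (1 - s * B * q ^ N)"
  have D: "D \<noteq> 0" using Suc.prems by (auto simp: qpoch_Suc D_def)
  have "(\<Sum>i\<le>Suc N. D * T (Suc N) i - (s - C * q ^ N) * (1 - B * q ^ N) * T N i) = 0"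
    unfolding T_def D_def
    using Suc.prems D \<open>q \<noteq> 0\<close>
    by (subst q_pfaff_saalschutz_partial_sum) (simp_all add: D_def qpoch_inverse_power_eq_0)
  then have "D * (\<Sum>i\<le>Suc N. T (Suc N) i)
      - (s - C * q ^ N) * (1 - B * q ^ N) * (\<Sum>i\<le>Suc N. T N i) = 0"
    by (simp only: sum_subtractf sum_distrib_left)
  also have "(\<Sum>i\<le>Suc N. T N i) = (\<Sum>i\<le>N. T N i)"
    using \<open>q \<noteq> 0\<close> by (simp add: T_def qpoch_inverse_power_eq_0)
  also have "\<dots> = qpoch B q N * (\<Prod>i<N. s - C * q ^ i) / (qpoch C q N * qpoch (s * B) q N)"
    unfolding T_def using Suc by (simp add: qpoch_Suc)
  finally have eq: "D * (\<Sum>i\<le>Suc N. T (Suc N) i) - (s - C * q ^ N) * (1 - B * q ^ N)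
      * (qpoch B q N * (\<Prod>i<N. s - C * q ^ i) / (qpoch C q N * qpoch (s * B) q N)) = 0" .
  have "S = R / D" if "D * S - R = 0" for S R
    using that D by (simp add: eq_divide_eq mult.commute)
  from this[OF eq] have "(\<Sum>i\<le>Suc N. T (Suc N) i) = (s - C * q ^ N) * (1 - B * q ^ N)
      * (qpoch B q N * (\<Prod>i<N. s - C * q ^ i) / (qpoch C q N * qpoch (s * B) q N)) / D" .
  also have "\<dots> = qpoch B q (Suc N) * (\<Prod>i<Suc N. s - C * q ^ i) / (qpoch C q (Suc N) * qpoch (s * B) q (Suc N))"
    by (simp add: D_def qpoch_Suc mult_ac)
  finally show ?case unfolding T_def .
qed simp

section \<open>Symmetry of the big q-Jacobi polynomials\<close>

lemma sum_triangle:
  fixes h :: "nat \<Rightarrow> nat \<Rightarrow> 'a::comm_monoid_add"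
  shows "(\<Sum>k\<le>n. \<Sum>i\<le>n - k. h k i) = (\<Sum>m\<le>n. \<Sum>k\<le>m. h k (m - k))"
proof -
  have "(\<Sum>k\<le>n. \<Sum>i\<le>n - k. h k i) = (\<Sum>(k, i)\<in>Sigma {..n} (\<lambda>k. {..n - k}). h k i)"
    by (rule sum.Sigma) auto
  also have "Sigma {..n} (\<lambda>k. {..n - k}) = {(k, i). k + i \<le> n}" by auto
  finally show ?thesis by (simp only: sum.triangle_reindex_eq)
qed

lemma big_q_jacobi_altdef:
  "big_q_jacobi n x a b c q = (\<Sum>j\<le>n. qpoch (inverse (q ^ n)) q j * qpoch (a * b * q ^ (n + 1)) q j
     * qpoch x q j / (qpoch (a * q) q j * qpoch (c * q) q j * qpoch q q j) * q ^ j)"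
  by (simp add: big_q_jacobi_def qpochs_def power_int_minus mult.assoc)

lemma qbinom_eq_divide:
  assumes "qpoch q q n \<noteq> 0" "k \<le> n"
  shows "qbinom q n k = qpoch q q n / (qpoch q q k * qpoch q q (n - k))"
  using qbinom_fact[OF assms(2), of q] assms(1) by (auto simp: eq_divide_eq)

text \<open>After the change of basis, the coefficient of \<open>(y; q)\<^sub>k\<close> is a \<open>\<^sub>3\<phi>\<^sub>2\<close> with upper parameters
  \<open>q\<^sup>k\<^sup>-\<^sup>n\<close>, \<open>a b q\<^sup>n\<^sup>+\<^sup>1\<^sup>+\<^sup>k\<close>, \<open>s\<close> and lower parameters \<open>a q\<^sup>k\<^sup>+\<^sup>1\<close>, \<open>s b q\<^sup>k\<^sup>+\<^sup>1\<close>. It is balanced precisely because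
  the third parameter of the polynomial and the scaling of its argument are linked by
  \<open>s = c / b\<close>, which is why \<open>s\<close> and \<open>y\<close> are used here in place of \<open>c\<close> and \<open>x\<close>.\<close>

theorem big_q_jacobi_symmetry:
  fixes q a b s y :: "'a::field"
  assumes q: "q \<noteq> 0" and s: "s \<noteq> 0"
    and nz: "qpoch q q n \<noteq> 0" "qpoch (a * q) q n \<noteq> 0" "qpoch (s * b * q) q n \<noteq> 0"
      "qpoch (b * q) q n \<noteq> 0" "qpoch (a / s * q) q n \<noteq> 0"
  shows "big_q_jacobi n (y * s) a b (s * b) q
    = s ^ n * (qpoch (b * q) q n * qpoch (a / s * q) q n / (qpoch (a * q) q n * qpoch (s * b * q) q n))
      * big_q_jacobi n y b a (a / s) q"
proof -
  \<comment> \<open>\<open>g k\<close> collects what depends on \<open>k\<close> only; \<open>h k i\<close> is the \<open>i\<close>-th term of the balanced series.\<close>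
  define A where "A = a * b * q ^ (n + 1)"
  define g where "g = (\<lambda>k. s ^ k * qpoch y q k * qpoch (inverse (q ^ n)) q k * qpoch A q k
    / (qpoch (a * q) q k * qpoch (s * b * q) q k * qpoch q q k) * q ^ k)"
  define h where "h = (\<lambda>k i. qpoch (inverse (q ^ (n - k))) q i * qpoch (A * q ^ k) q i * qpoch s q i
    / (qpoch (a * q * q ^ k) q i * qpoch (s * b * q * q ^ k) q i * qpoch q q i) * q ^ i)"
  have "big_q_jacobi n (y * s) a b (s * b) q = (\<Sum>j\<le>n. \<Sum>k\<le>j. g k * h k (j - k))"
    unfolding big_q_jacobi_altdef A_def [symmetric]
  proof (rule sum.cong)
    fix j assume j: "j \<in> {..n}"
    have "qpoch (y * s) q j = (\<Sum>k\<le>j. qpoch q q j / (qpoch q q k * qpoch q q (j - k))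
        * (s ^ k * qpoch y q k * qpoch s q (j - k)))"
      unfolding qpoch_mult using nz(1) j
      by (intro sum.cong refl) (simp add: qbinom_eq_divide qpoch_nonzero_mono[of q q n])
    then have "qpoch (inverse (q ^ n)) q j * qpoch A q j * qpoch (y * s) q j
         / (qpoch (a * q) q j * qpoch (s * b * q) q j * qpoch q q j) * q ^ j
      = (\<Sum>k\<le>j. qpoch (inverse (q ^ n)) q j * qpoch A q j * (qpoch q q j / (qpoch q q k * qpoch q q (j - k))
        * (s ^ k * qpoch y q k * qpoch s q (j - k)))
         / (qpoch (a * q) q j * qpoch (s * b * q) q j * qpoch q q j) * q ^ j)"
      by (simp add: sum_distrib_left sum_distrib_right sum_divide_distrib)
    also have "\<dots> = (\<Sum>k\<le>j. g k * h k (j - k))"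
    proof (rule sum.cong)
      fix k assume "k \<in> {..j}"
      then have k: "k \<le> j" "k \<le> n" using j by auto
      have "q ^ j = q ^ k * q ^ (j - k)" using k by (simp add: power_add [symmetric])
      moreover have "qpoch q q j \<noteq> 0" using nz(1) j by (simp add: qpoch_nonzero_mono[of q q n])
      ultimately show "qpoch (inverse (q ^ n)) q j * qpoch A q j * (qpoch q q j / (qpoch q q k * qpoch q q (j - k))
        * (s ^ k * qpoch y q k * qpoch s q (j - k)))
         / (qpoch (a * q) q j * qpoch (s * b * q) q j * qpoch q q j) * q ^ j = g k * h k (j - k)"
        unfolding g_def h_def qpoch_inverse_power_shift[OF q k(2), symmetric]
          qpoch_split[OF k(1), of "inverse (q ^ n)" q] qpoch_split[OF k(1), of A q]
          qpoch_split[OF k(1), of "a * q" q] qpoch_split[OF k(1), of "s * b * q" q]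
        by (simp add: mult_ac)
    qed simp
    finally show "qpoch (inverse (q ^ n)) q j * qpoch A q j * qpoch (y * s) q j
         / (qpoch (a * q) q j * qpoch (s * b * q) q j * qpoch q q j) * q ^ j
       = (\<Sum>k\<le>j. g k * h k (j - k))" .
  qed simp
  also have "\<dots> = (\<Sum>k\<le>n. g k * (\<Sum>i\<le>n - k. h k i))"
    using sum_triangle[of "\<lambda>k i. g k * h k i" n] by (simp add: sum_distrib_left)
  also have "\<dots> = (\<Sum>k\<le>n. s ^ n * (qpoch (b * q) q n * qpoch (a / s * q) q n / (qpoch (a * q) q n * qpoch (s * b * q) q n))
      * (qpoch (inverse (q ^ n)) q k * qpoch A q k
     * qpoch y q k / (qpoch (b * q) q k * qpoch (a / s * q) q k * qpoch q q k) * q ^ k))"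
  proof (rule sum.cong)
    fix k assume "k \<in> {..n}"
    then have k: "k \<le> n" by simp
    define N where "N = n - k"
    have n: "n = k + N" using k by (simp add: N_def)
    note split = qpoch_split[OF k, folded N_def]
    have "(\<Sum>i\<le>N. h k i) = (\<Sum>i\<le>N. qpoch (inverse (q ^ N)) q i * qpoch (a * q * q ^ k * (b * q * q ^ k) * q ^ N / q) q i * qpoch s q i
            / (qpoch (a * q * q ^ k) q i * qpoch (s * (b * q * q ^ k)) q i * qpoch q q i) * q ^ i)"
    proof -
      have "a * q * q ^ k * (b * q * q ^ k) * q ^ N / q = A * q ^ k"
        using q by (simp add: A_def n power_add)
      then show ?thesis by (simp add: h_def N_def mult.assoc)
    qed
    also have "\<dots> = qpoch (b * q * q ^ k) q N * (\<Prod>i<N. s - a * q * q ^ k * q ^ i)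
        / (qpoch (a * q * q ^ k) q N * qpoch (s * (b * q * q ^ k)) q N)"
      using nz split[of "a * q" q] split[of "s * b * q" q] qpoch_nonzero_mono[of q q n N] q n
      by (intro q_pfaff_saalschutz) (auto simp: mult.assoc)
    also have "(\<Prod>i<N. s - a * q * q ^ k * q ^ i) = s ^ N * qpoch (a / s * q * q ^ k) q N"
    proof -
      have "s - a * q * q ^ k * q ^ i = s * (1 - a / s * q * q ^ k * q ^ i)" for i
        using s by (simp add: right_diff_distrib)
      then show ?thesis by (simp add: qpoch_def prod.distrib)
    qed
    also have "s * (b * q * q ^ k) = s * b * q * q ^ k" by (simp add: mult.assoc)
    finally have *: "(\<Sum>i\<le>N. h k i) = qpoch (b * q * q ^ k) q N * (s ^ N * qpoch (a / s * q * q ^ k) q N)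
        / (qpoch (a * q * q ^ k) q N * qpoch (s * b * q * q ^ k) q N)" .
    have "qpoch (b * q) q k \<noteq> 0" "qpoch (a / s * q) q k \<noteq> 0"
      using nz k qpoch_nonzero_mono by blast+
    moreover have "s ^ n = s ^ k * s ^ N" by (simp add: n power_add)
    ultimately show "g k * (\<Sum>i\<le>n - k. h k i) = s ^ n * (qpoch (b * q) q n * qpoch (a / s * q) q n / (qpoch (a * q) q n * qpoch (s * b * q) q n))
      * (qpoch (inverse (q ^ n)) q k * qpoch A q k
     * qpoch y q k / (qpoch (b * q) q k * qpoch (a / s * q) q k * qpoch q q k) * q ^ k)"
      unfolding N_def [symmetric] * g_def split[of "b * q" q] split[of "a / s * q" q]
        split[of "a * q" q] split[of "s * b * q" q]
      by (simp add: mult_ac)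
  qed simp
  also have "\<dots> = s ^ n * (qpoch (b * q) q n * qpoch (a / s * q) q n / (qpoch (a * q) q n * qpoch (s * b * q) q n))
      * big_q_jacobi n y b a (a / s) q"
    unfolding big_q_jacobi_altdef A_def by (simp only: sum_distrib_left mult.commute[of b a])
  finally show ?thesis .
qed

section \<open>From big q-Jacobi to big q-Laguerre polynomials\<close>

text \<open>The theorem over a field. After the symmetry has been applied, the factors of a summand that
  involve \<open>k\<close> and \<open>j\<close> separately, \<open>v k j\<close> in the proof, form \<open>1 / (q; q)\<^sub>m\<close> times a term of
  \<open>sum_qbinom_qpoch_eq_1\<close> for \<open>m = k + j\<close>; everything else depends on \<open>m\<close> alone.\<close>

theorem big_q_jacobi_sum:
  fixes q a b s y :: "'a::field"
  assumes q: "q \<noteq> 0" and s: "s \<noteq> 0"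
    and nz: "qpoch q q n \<noteq> 0" "qpoch (a * q) q n \<noteq> 0" "qpoch (s * b * q) q n \<noteq> 0"
      "qpoch (b * q) q n \<noteq> 0" "qpoch (a / s * q) q n \<noteq> 0"
  shows "(\<Sum>k\<le>n. qpoch (inverse (q ^ n)) q k * qpoch y q k
        / (qpoch q q k * qpoch (a * q) q k * qpoch (s * b * q) q k)
        * (a * (s * b)) ^ k * q ^ (k * (k + n + 1))
        * big_q_jacobi (n - k) (y * s * q ^ k) (a * q ^ k) (b * q ^ k) (s * b * q ^ k) q)
    = s ^ n * (qpoch (b * q) q n * qpoch (a / s * q) q n / (qpoch (a * q) q n * qpoch (s * b * q) q n))
      * big_q_jacobi n y b 0 (a / s) q"
proof -
  define A where "A = a * b * q ^ (n + 1)"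
  define K where "K = s ^ n * (qpoch (b * q) q n * qpoch (a / s * q) q n
      / (qpoch (a * q) q n * qpoch (s * b * q) q n))"
  define u where "u = (\<lambda>m. qpoch (inverse (q ^ n)) q m * qpoch y q m
      / (qpoch (b * q) q m * qpoch (a / s * q) q m) * q ^ m)"
  define v where "v = (\<lambda>k j. A ^ k * q ^ (k * (k - 1)) * qpoch (A * q ^ k) q j / (qpoch q q k * qpoch q q j))"
  have "(\<Sum>k\<le>n. qpoch (inverse (q ^ n)) q k * qpoch y q k
        / (qpoch q q k * qpoch (a * q) q k * qpoch (s * b * q) q k)
        * (a * (s * b)) ^ k * q ^ (k * (k + n + 1))
        * big_q_jacobi (n - k) (y * s * q ^ k) (a * q ^ k) (b * q ^ k) (s * b * q ^ k) q)
      = (\<Sum>k\<le>n. \<Sum>j\<le>n - k. K * u (k + j) * v k j)"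
  proof (rule sum.cong)
    fix k assume "k \<in> {..n}"
    then have k: "k \<le> n" by simp
    define N where "N = n - k"
    have n: "n = k + N" using k by (simp add: N_def)
    note split = qpoch_split[OF k, folded N_def]
    have e: "a * q ^ k * q = a * q * q ^ k" "b * q ^ k * q = b * q * q ^ k"
      "s * (b * q ^ k) * q = s * b * q * q ^ k" "a * q ^ k / s * q = a / s * q * q ^ k"
      "b * q ^ k * (a * q ^ k) * q ^ (N + 1) = A * q ^ k"
      by (simp_all add: A_def n power_add mult_ac)
    have "big_q_jacobi N (y * q ^ k * s) (a * q ^ k) (b * q ^ k) (s * (b * q ^ k)) q
      = s ^ N * (qpoch (b * q ^ k * q) q N * qpoch (a * q ^ k / s * q) q N
          / (qpoch (a * q ^ k * q) q N * qpoch (s * (b * q ^ k) * q) q N))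
        * big_q_jacobi N (y * q ^ k) (b * q ^ k) (a * q ^ k) (a * q ^ k / s) q"
      using nz k q s n unfolding split[of "a * q" q] split[of "s * b * q" q] split[of "b * q" q] split[of "a / s * q" q]
      by (intro big_q_jacobi_symmetry) (auto simp: e qpoch_nonzero_mono[of q q n])
    also have "big_q_jacobi N (y * q ^ k) (b * q ^ k) (a * q ^ k) (a * q ^ k / s) q
      = (\<Sum>j\<le>N. qpoch (inverse (q ^ N)) q j * qpoch (A * q ^ k) q j * qpoch (y * q ^ k) q j
       / (qpoch (b * q * q ^ k) q j * qpoch (a / s * q * q ^ k) q j * qpoch q q j) * q ^ j)"
      unfolding big_q_jacobi_altdef e ..
    finally have sym: "big_q_jacobi N (y * s * q ^ k) (a * q ^ k) (b * q ^ k) (s * b * q ^ k) q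
      = s ^ N * (qpoch (b * q * q ^ k) q N * qpoch (a / s * q * q ^ k) q N
          / (qpoch (a * q * q ^ k) q N * qpoch (s * b * q * q ^ k) q N))
        * (\<Sum>j\<le>N. qpoch (inverse (q ^ N)) q j * qpoch (A * q ^ k) q j * qpoch (y * q ^ k) q j
       / (qpoch (b * q * q ^ k) q j * qpoch (a / s * q * q ^ k) q j * qpoch q q j) * q ^ j)"
      unfolding e by (simp add: mult_ac)
    \<comment> \<open>One factor \<open>q\<^sup>k\<close> is split off to complete the \<open>q\<^sup>j\<close> of the inner series to \<open>q\<^sup>k\<^sup>+\<^sup>j\<close>.\<close>
    have pow: "(a * (s * b)) ^ k * q ^ (k * (k + n + 1)) = s ^ k * (A ^ k * q ^ (k * (k - 1))) * q ^ k"
    proof (cases k)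
      case (Suc l)
      have "q ^ (k * (k + n + 1)) = q ^ ((n + 1) * k + k * (k - 1) + k)"
        by (rule arg_cong[where f = "\<lambda>e. q ^ e"]) (simp add: Suc algebra_simps)
      then have "q ^ (k * (k + n + 1)) = (q ^ (n + 1)) ^ k * q ^ (k * (k - 1)) * q ^ k"
        by (simp only: power_add power_mult)
      then show ?thesis
        unfolding A_def by (simp only: power_mult_distrib mult_ac)
    qed simp
    have nz': "qpoch (b * q) q k \<noteq> 0" "qpoch (a / s * q) q k \<noteq> 0"
      using nz k qpoch_nonzero_mono by blast+
    have sp: "s ^ n = s ^ k * s ^ N" by (simp add: n power_add)
    show "qpoch (inverse (q ^ n)) q k * qpoch y q k
        / (qpoch q q k * qpoch (a * q) q k * qpoch (s * b * q) q k)
        * (a * (s * b)) ^ k * q ^ (k * (k + n + 1))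
        * big_q_jacobi (n - k) (y * s * q ^ k) (a * q ^ k) (b * q ^ k) (s * b * q ^ k) q
      = (\<Sum>j\<le>n - k. K * u (k + j) * v k j)"
      unfolding N_def [symmetric] sym sum_distrib_left
    proof (rule sum.cong)
      fix j
      show "qpoch (inverse (q ^ n)) q k * qpoch y q k
        / (qpoch q q k * qpoch (a * q) q k * qpoch (s * b * q) q k)
        * (a * (s * b)) ^ k * q ^ (k * (k + n + 1))
        * (s ^ N * (qpoch (b * q * q ^ k) q N * qpoch (a / s * q * q ^ k) q N
          / (qpoch (a * q * q ^ k) q N * qpoch (s * b * q * q ^ k) q N))
        * (qpoch (inverse (q ^ N)) q j * qpoch (A * q ^ k) q j * qpoch (y * q ^ k) q j
       / (qpoch (b * q * q ^ k) q j * qpoch (a / s * q * q ^ k) q j * qpoch q q j) * q ^ j))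
       = K * u (k + j) * v k j"
        unfolding mult.assoc[of _ "(a * (s * b)) ^ k"] pow K_def u_def v_def sp
          qpoch_add power_add N_def qpoch_inverse_power_shift[OF q k, symmetric]
          split[of "b * q" q, unfolded N_def] split[of "a / s * q" q, unfolded N_def]
          split[of "a * q" q, unfolded N_def] split[of "s * b * q" q, unfolded N_def]
        using nz' by (simp add: mult_ac)
    qed simp
  qed simp
  also have "\<dots> = (\<Sum>m\<le>n. K * u m * (\<Sum>k\<le>m. v k (m - k)))"
    unfolding sum_triangle sum_distrib_left by (intro sum.cong) auto
  also have "\<dots> = (\<Sum>m\<le>n. K * u m * (1 / qpoch q q m))"
  proof (rule sum.cong)
    fix m assume "m \<in> {..n}"
    then have m: "qpoch q q m \<noteq> 0" using nz(1) by (simp add: qpoch_nonzero_mono[of q q n])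
    have "qpoch q q m * (\<Sum>k\<le>m. v k (m - k)) = 1"
      unfolding sum_qbinom_qpoch_eq_1[of q m A, symmetric] sum_distrib_left
      using m by (intro sum.cong) (auto simp: v_def qbinom_eq_divide)
    then show "K * u m * (\<Sum>k\<le>m. v k (m - k)) = K * u m * (1 / qpoch q q m)"
      using m by (simp add: eq_divide_eq mult.commute)
  qed simp
  also have "\<dots> = K * big_q_jacobi n y b 0 (a / s) q"
  proof -
    have "qpoch 0 q m = 1" for m by (simp add: qpoch_def)
    then show ?thesis
      by (simp add: big_q_jacobi_altdef sum_distrib_left u_def mult_ac)
  qed
  finally show ?thesis unfolding K_def .
qed

section \<open>Real parameters and complex argument\<close>

lemma qpoch_pos:
  fixes y q :: real
  assumes "0 \<le> q" "q < 1" "y < 1"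
  shows "qpoch y q n > 0"
  unfolding qpoch_def
proof (rule prod_pos)
  fix j
  have q: "0 \<le> q ^ j" "q ^ j \<le> 1" using assms by (simp_all add: power_le_one)
  have "y * q ^ j < 1"
  proof (cases "y \<le> 0")
    case True
    then show ?thesis using q mult_nonpos_nonneg[of y "q ^ j"] by simp
  next
    case False
    then have "y * q ^ j \<le> y" using q by (intro mult_left_le) auto
    then show ?thesis using assms by simp
  qed
  then show "0 < 1 - y * q ^ j" by simp
qed

lemma of_real_qpoch: "of_real (qpoch y q k) = qpoch (of_real y) (of_real q) k"
  by (simp add: qpoch_def)

theorem mainTheorem15:
  fixes q a b c :: real and x :: complex and n :: nat
  assumes "0 < q" "q < 1"
    and "0 < a" "a < inverse q"
    and "0 < b" "b < inverse q"
    and "c < 0"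
  shows "(\<Sum>k\<le>n. qpochs [of_real q powi (- int n), x * of_real b / of_real c] (of_real q) k
                / qpochs [of_real q, of_real (a * q), of_real (c * q)] (of_real q) k
                * of_real (a * c) ^ k * of_real q ^ (k * (k + n + 1))
                * big_q_jacobi (n - k) (x * of_real q ^ k) (of_real (a * q ^ k))
                    (of_real (b * q ^ k)) (of_real (c * q ^ k)) (of_real q))
         = of_real (c / b) ^ n
           * (of_real (qpochs [b * q, a * b * q / c] q n) / of_real (qpochs [a * q, c * q] q n))
           * big_q_jacobi n (x * of_real b / of_real c) (of_real b) 0 (of_real (a * b / c)) (of_real q)"
proof -
  define Q A B s y :: complex where "Q = of_real q" and "A = of_real a" and "B = of_real b"
    and "s = of_real (c / b)" and "y = x * of_real b / of_real c"
  have C: "of_real c = s * B" and x: "x = y * s" and d: "of_real (a * b / c) = A / s"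
    and s: "s \<noteq> 0"
    using assms by (simp_all add: s_def y_def A_def B_def)
  have nz: "qpoch (of_real z) Q n \<noteq> 0" if "z < 1" for z
    using qpoch_pos[of q z n] that assms by (simp add: Q_def flip: of_real_qpoch)
  have "a * q < 1" "b * q < 1" using assms by (simp_all add: field_simps)
  moreover have "c * q < 0" "a * b / c * q < 0"
    using assms by (simp_all only: mult_neg_pos divide_pos_neg mult_pos_pos)
  moreover have "complex_of_real (a * q) = A * Q" "complex_of_real (b * q) = B * Q"
    "complex_of_real (c * q) = s * B * Q" "complex_of_real (a * b / c * q) = A / s * Q"
    by (simp_all only: of_real_mult[of _ q] C d) (simp_all add: A_def B_def Q_def)
  ultimately have "qpoch (A * Q) Q n \<noteq> 0" "qpoch (B * Q) Q n \<noteq> 0" "qpoch (s * B * Q) Q n \<noteq> 0"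
    "qpoch (A / s * Q) Q n \<noteq> 0" "qpoch Q Q n \<noteq> 0"
    using nz[of "a * q"] nz[of "b * q"] nz[of "c * q"] nz[of "a * b / c * q"] nz[of q] assms(2)
    unfolding Q_def [symmetric] by argo+
  moreover have "Q \<noteq> 0" using assms by (simp add: Q_def)
  ultimately show ?thesis
    using big_q_jacobi_sum[of Q s n A B y] s
    unfolding y_def [symmetric] C [symmetric] d [symmetric] x [symmetric]
    by (simp add: qpochs_def of_real_qpoch power_int_minus A_def B_def Q_def s_def mult_ac)
qed

end
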